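(* Fix a positive integer $k$ and let $q=p^{\ell}$ be an odd prime power with $p\ge k$ prime. There is a constant $C$ depending only on $k$ and $q$ such that for every $n\ge1$, if $A\subseteq\mathbb{F}_q^n$ contains no pairwise distinct vectors $\vec{x}_1,\ldots,\vec{x}_k$ with $\langle \vec{x}_i-\vec{x}_j,\vec{x}_j-\vec{x}_\ell\rangle=0$ for all pairwise distinct $i,j,\ell\in\{1,\ldots,k\}$, then $|A|\le C n^{(k+1)(q-1)}$.
   Context: $\langle \vec{u},\vec{v}\rangle=\sum_{s=1}^n u_s v_s$ is the standard bilinear form on $\mathbb{F}_q^n$. *)

theory Defs
  imports
    "Jordan_Normal_Form.Matrix"
    "HOL-Computational_Algebra.Primes"
    "HOL-Library.Cardinality"
begin

end

theory Submission
  imports Defs "HOL-Number_Theory.Residues"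
begin

text \<open>
  Join two distinct vectors whose difference is isotropic. As 2 is invertible, polarization shows
  that every clique on k vertices of this graph satisfies the forbidden orthogonality relations, so
  A is clique-free. By Fermat, 1 - Q(x - y)^(q-1), with Q(v) the square norm of v, is the identity
  matrix on an independent set, while its rank is at most (n+2)^(q-1) + 1; hence independent sets
  have size O(n^(q-1)). The Erdos-Szekeres recursion for Ramsey numbers then bounds |A| by the
  k-th power of this.
\<close>

section \<open>Kernels of bounded rank\<close>

text \<open>Over a field this says that the matrix with entries \<open>f x y\<close>, for
  \<open>x\<close> and \<open>y\<close> in \<open>S\<close>, has rank at most \<open>r\<close>.
  Separating the variables avoids numbering the elements of \<open>S\<close> and makes sums and
  products of kernels easy to handle.\<close>

definition kernel_rank_le :: "('x \<Rightarrow> 'x \<Rightarrow> 'a::comm_ring_1) \<Rightarrow> 'x set \<Rightarrow> nat \<Rightarrow> bool" where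
  "kernel_rank_le f S r \<longleftrightarrow>
    (\<exists>g h. \<forall>x\<in>S. \<forall>y\<in>S. f x y = (\<Sum>i<r. g i x * h i y))"

lemma kernel_rank_leI:
  assumes "\<And>x y. x \<in> S \<Longrightarrow> y \<in> S \<Longrightarrow> f x y = (\<Sum>i<r. g i x * h i y)"
  shows "kernel_rank_le f S r"
  using assms unfolding kernel_rank_le_def by blast

lemma kernel_rank_leE:
  assumes "kernel_rank_le f S r"
  obtains g h where "\<And>x y. x \<in> S \<Longrightarrow> y \<in> S \<Longrightarrow> f x y = (\<Sum>i<r. g i x * h i y)"
  using assms unfolding kernel_rank_le_def by blast

lemma kernel_rank_le_cong:
  assumes "\<And>x y. x \<in> S \<Longrightarrow> y \<in> S \<Longrightarrow> f x y = f' x y"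
  shows "kernel_rank_le f S r \<longleftrightarrow> kernel_rank_le f' S r"
  unfolding kernel_rank_le_def using assms by simp

lemma kernel_rank_le_mono:
  assumes "kernel_rank_le f S r" "T \<subseteq> S"
  shows "kernel_rank_le f T r"
  using assms unfolding kernel_rank_le_def by blast

lemma kernel_rank_le_product: "kernel_rank_le (\<lambda>x y. u x * v y) S 1"
  by (rule kernel_rank_leI[where g = "\<lambda>_. u" and h = "\<lambda>_. v"]) simp

lemma kernel_rank_le_add:
  assumes "kernel_rank_le f S r" "kernel_rank_le f' S r'"
  shows "kernel_rank_le (\<lambda>x y. f x y + f' x y) S (r + r')"
proof -
  obtain g h where gh: "\<And>x y. x \<in> S \<Longrightarrow> y \<in> S \<Longrightarrow> f x y = (\<Sum>i<r. g i x * h i y)"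
    using assms(1) by (rule kernel_rank_leE) blast
  obtain g' h' where gh': "\<And>x y. x \<in> S \<Longrightarrow> y \<in> S \<Longrightarrow> f' x y = (\<Sum>i<r'. g' i x * h' i y)"
    using assms(2) by (rule kernel_rank_leE) blast
  have split: "(\<Sum>i<r + r'. F i) = (\<Sum>i<r. F i) + (\<Sum>i<r'. F (r + i))" for F :: "nat \<Rightarrow> 'b"
    by (induction r') (auto simp: add.assoc)
  show ?thesis
    by (rule kernel_rank_leI[where g = "\<lambda>i. if i < r then g i else g' (i - r)"
          and h = "\<lambda>i. if i < r then h i else h' (i - r)"])
       (simp add: split gh gh')
qed

lemma kernel_rank_le_mult:
  assumes "kernel_rank_le f S r" "kernel_rank_le f' S r'"
  shows "kernel_rank_le (\<lambda>x y. f x y * f' x y) S (r * r')"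
proof -
  obtain g h where gh: "\<And>x y. x \<in> S \<Longrightarrow> y \<in> S \<Longrightarrow> f x y = (\<Sum>i<r. g i x * h i y)"
    using assms(1) by (rule kernel_rank_leE) blast
  obtain g' h' where gh': "\<And>x y. x \<in> S \<Longrightarrow> y \<in> S \<Longrightarrow> f' x y = (\<Sum>i<r'. g' i x * h' i y)"
    using assms(2) by (rule kernel_rank_leE) blast
  \<comment> \<open>Expanding the product of the two sums gives terms indexed by pairs;
    \<open>b\<close> renumbers the pairs by an initial segment of the naturals.\<close>
  obtain b where b: "bij_betw b {..<r * r'} ({..<r} \<times> {..<r'})"
    using finite_same_card_bij[of "{..<r * r'}" "{..<r} \<times> {..<r'}"] by auto
  show ?thesis
  proof (rule kernel_rank_leI[where g = "\<lambda>i x. g (fst (b i)) x * g' (snd (b i)) x"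
        and h = "\<lambda>i y. h (fst (b i)) y * h' (snd (b i)) y"])
    fix x y assume xy: "x \<in> S" "y \<in> S"
    have "f x y * f' x y = (\<Sum>i<r. \<Sum>j<r'. (g i x * h i y) * (g' j x * h' j y))"
      using xy by (simp add: gh gh' sum_product)
    also have "\<dots> = (\<Sum>p\<in>{..<r} \<times> {..<r'}.
        (g (fst p) x * g' (snd p) x) * (h (fst p) y * h' (snd p) y))"
      by (simp add: sum.cartesian_product case_prod_beta mult_ac)
    also have "\<dots> = (\<Sum>i<r * r'. (g (fst (b i)) x * g' (snd (b i)) x)
        * (h (fst (b i)) y * h' (snd (b i)) y))"
      by (rule sum.reindex_bij_betw[OF b, symmetric])
    finally show "f x y * f' x y = \<dots>" .
  qed
qed

lemma kernel_rank_le_power: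
  assumes "kernel_rank_le f S r"
  shows "kernel_rank_le (\<lambda>x y. f x y ^ d) S (r ^ d)"
proof (induction d)
  case 0
  show ?case using kernel_rank_le_product[of "\<lambda>_. 1" "\<lambda>_. 1" S] by simp
next
  case (Suc d)
  then show ?case using kernel_rank_le_mult[OF assms Suc] by simp
qed

text \<open>
  Over a finite field the rank of the identity matrix is bounded by counting: a vector c indexed by S
  is recovered from its r pairings with the functions g i.
\<close>

lemma card_le_kernel_rank:
  fixes f :: "'x \<Rightarrow> 'x \<Rightarrow> 'a::{field, finite}"
  assumes "finite S" "kernel_rank_le f S r"
    and f: "\<And>x y. x \<in> S \<Longrightarrow> y \<in> S \<Longrightarrow> f x y = (if x = y then 1 else 0)"
  shows "card S \<le> r"
proof -
  obtain g h where gh: "\<And>x y. x \<in> S \<Longrightarrow> y \<in> S \<Longrightarrow> f x y = (\<Sum>i<r. g i x * h i y)"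
    using assms(2) by (rule kernel_rank_leE) blast
  \<comment> \<open>Restricting \<open>T c\<close> to \<open>{..<r}\<close> makes it extensional, so
    that the possible values of \<open>T\<close> can be counted by \<open>card_PiE\<close>.\<close>
  define T where "T c = (\<lambda>i\<in>{..<r}. \<Sum>x\<in>S. c x * g i x)" for c :: "'x \<Rightarrow> 'a"
  have recover: "c y = (\<Sum>i<r. T c i * h i y)" if "y \<in> S" for c y
  proof -
    have "(\<Sum>i<r. T c i * h i y) = (\<Sum>i<r. \<Sum>x\<in>S. c x * (g i x * h i y))"
      by (simp add: T_def sum_distrib_right mult.assoc)
    also have "\<dots> = (\<Sum>x\<in>S. c x * (\<Sum>i<r. g i x * h i y))"
      by (subst sum.swap) (simp add: sum_distrib_left)
    also have "\<dots> = (\<Sum>x\<in>S. if x = y then c x else 0)"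
      using that by (intro sum.cong) (auto simp flip: gh simp: f)
    also have "\<dots> = c y"
      using that \<open>finite S\<close> by simp
    finally show ?thesis by simp
  qed
  have "inj_on T (S \<rightarrow>\<^sub>E UNIV)"
  proof (rule inj_onI)
    fix c d assume "c \<in> S \<rightarrow>\<^sub>E (UNIV :: 'a set)" "d \<in> S \<rightarrow>\<^sub>E (UNIV :: 'a set)" and "T c = T d"
    then show "c = d"
      by (intro PiE_ext[of c S _ d]) (auto simp: recover)
  qed
  moreover have "T ` (S \<rightarrow>\<^sub>E UNIV) \<subseteq> {..<r} \<rightarrow>\<^sub>E UNIV"
    by (auto simp: T_def split: if_splits)
  ultimately have "card (S \<rightarrow>\<^sub>E (UNIV :: 'a set)) \<le> card ({..<r} \<rightarrow>\<^sub>E (UNIV :: 'a set))"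
    by (intro card_inj_on_le) (auto intro: finite_PiE)
  then have "CARD('a) ^ card S \<le> CARD('a) ^ r"
    using \<open>finite S\<close> by (simp add: card_PiE)
  moreover have "CARD('a) > 1"
    using card_mono[of UNIV "{0, 1 :: 'a}"] by simp
  ultimately show ?thesis
    using power_le_imp_le_exp by blast
qed

section \<open>The squared distance kernel\<close>

lemma scalar_prod_minus_minus:
  fixes x y :: "'a::comm_ring_1 vec"
  assumes "x \<in> carrier_vec n" "y \<in> carrier_vec n"
  shows "(x - y) \<bullet> (x - y) = x \<bullet> x + y \<bullet> y - 2 * (x \<bullet> y)"
  using assms comm_scalar_prod[OF assms]
  by (simp add: minus_scalar_prod_distrib[of _ n] scalar_prod_minus_distrib[of _ n])

text \<open>In the expansion of the squared distance, the mixed term contributes one summand per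
  coordinate, and each of the two square norms contributes one more.\<close>

lemma kernel_rank_le_square_distance:
  "kernel_rank_le (\<lambda>x y. (x - y) \<bullet> (x - y)) (carrier_vec n :: 'a::comm_ring_1 vec set) (n + 2)"
proof -
  let ?V = "carrier_vec n :: 'a vec set"
  have "kernel_rank_le (\<lambda>x y. - 2 * (x \<bullet> y)) ?V n"
    by (rule kernel_rank_leI[where g = "\<lambda>i x. - 2 * x $ i" and h = "\<lambda>i y. y $ i"])
       (auto simp: scalar_prod_def sum_distrib_left mult.assoc lessThan_atLeast0)
  \<comment> \<open>The factors 1 display each square norm as a function of \<open>x\<close> times a
    function of \<open>y\<close>.\<close>
  then have "kernel_rank_le (\<lambda>x y. - 2 * (x \<bullet> y) + ((x \<bullet> x) * 1 + 1 * (y \<bullet> y))) ?V (n + (1 + 1))"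
    by (intro kernel_rank_le_add kernel_rank_le_product)
  then show ?thesis
    by (subst kernel_rank_le_cong[where f' = "\<lambda>x y. - 2 * (x \<bullet> y) + ((x \<bullet> x) * 1 + 1 * (y \<bullet> y))"])
       (auto simp: scalar_prod_minus_minus numeral_2_eq_2)
qed

lemma finite_carrier_vec: "finite (carrier_vec n :: 'a::finite vec set)"
proof -
  have "carrier_vec n \<subseteq> vec_of_list ` {xs :: 'a list. set xs \<subseteq> UNIV \<and> length xs = n}"
  proof
    fix v :: "'a vec" assume "v \<in> carrier_vec n"
    then show "v \<in> vec_of_list ` {xs :: 'a list. set xs \<subseteq> UNIV \<and> length xs = n}"
      by (intro image_eqI[of _ _ "list_of_vec v"]) (auto simp: vec_list)
  qed
  then show ?thesis
    using finite_lists_length_eq[of "UNIV :: 'a set" n] by (auto intro: finite_subset)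
qed

section \<open>Fermat's theorem and independent sets\<close>

text \<open>Multiplication by \<open>x\<close> permutes the nonzero elements, so their product is
  unchanged by a factor \<open>x\<close> on each of them; cancel this nonzero product.\<close>

lemma finite_field_power_card_minus_1:
  fixes x :: "'a::{field, finite}"
  assumes "x \<noteq> 0"
  shows "x ^ (CARD('a) - 1) = 1"
proof -
  let ?U = "UNIV - {0 :: 'a}"
  have "bij_betw ((*) x) ?U ?U"
    using assms by (intro bij_betwI[of _ _ _ "\<lambda>y. y / x"]) auto
  then have "(\<Prod>y\<in>?U. y) = (\<Prod>y\<in>?U. x * y)"
    by (rule prod.reindex_bij_betw[symmetric])
  also have "\<dots> = x ^ (CARD('a) - 1) * (\<Prod>y\<in>?U. y)"
    by (simp add: prod.distrib card_Diff_singleton)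
  finally show ?thesis
    by simp
qed

text \<open>The characteristic divides the cardinality, so the odd number \<open>CARD('a)\<close>
  vanishes in the field; if 2 vanished too, so would 1.\<close>

lemma two_neq_zero_of_odd_card:
  assumes "odd CARD('a::{field, finite})"
  shows "(2 :: 'a) \<noteq> 0"
proof
  assume "(2 :: 'a) = 0"
  obtain m where m: "CARD('a) = 2 * m + 1"
    using assms by (auto elim: oddE)
  have "(of_nat (CARD('a)) :: 'a) = 0"
    using CHAR_dvd_CARD by (simp add: of_nat_eq_0_iff_char_dvd)
  then show False
    using \<open>(2 :: 'a) = 0\<close> by (simp add: m)
qed

lemma card_anisotropic_differences_le:
  fixes S :: "'a::{field, finite} vec set"
  assumes S: "S \<subseteq> carrier_vec n"
    and aniso: "\<And>x y. x \<in> S \<Longrightarrow> y \<in> S \<Longrightarrow> x \<noteq> y \<Longrightarrow> (x - y) \<bullet> (x - y) \<noteq> 0"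
  shows "card S \<le> (n + 2) ^ (CARD('a) - 1) + 1"
proof (rule card_le_kernel_rank)
  let ?d = "CARD('a) - 1"
  \<comment> \<open>This is 1 - Q(x - y)^(q-1), written so that the product and sum rules apply: the
    scalar -1 multiplies the rank bound by 1, and the constant 1 adds 1 to it.\<close>
  let ?f = "\<lambda>x y :: 'a vec. (- 1) * ((x - y) \<bullet> (x - y)) ^ ?d + 1 * 1"
  show "finite S"
    using S finite_carrier_vec by (rule finite_subset)
  have dist: "kernel_rank_le (\<lambda>x y. ((x - y) \<bullet> (x - y)) ^ ?d) S ((n + 2) ^ ?d)"
    by (intro kernel_rank_le_power kernel_rank_le_mono[OF _ S] kernel_rank_le_square_distance)
  have "kernel_rank_le (\<lambda>x y. (- 1) * ((x - y) \<bullet> (x - y)) ^ ?d) S (1 * (n + 2) ^ ?d)"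
    by (intro kernel_rank_le_mult dist)
       (use kernel_rank_le_product[of "\<lambda>_. - 1 :: 'a" "\<lambda>_. 1" S] in simp)
  then show "kernel_rank_le ?f S ((n + 2) ^ ?d + 1)"
    using kernel_rank_le_add[OF _ kernel_rank_le_product[of "\<lambda>_. 1" "\<lambda>_. 1"]] by force
  show "?f x y = (if x = y then 1 else 0)" if "x \<in> S" "y \<in> S" for x y
  proof (cases "x = y")
    case True
    moreover have "x - x = 0\<^sub>v n"
      using that S by auto
    \<comment> \<open>A positive exponent is needed for the power of 0 to vanish on the
      diagonal.\<close>
    moreover have "?d > 0"
      using card_mono[of UNIV "{0, 1 :: 'a}"] by simp
    ultimately show ?thesis by simp
  next
    case False
    then show ?thesis
      using finite_field_power_card_minus_1[OF aniso[OF that]] by simp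
  qed
qed

section \<open>A Ramsey bound for clique-free graphs\<close>

text \<open>A maximal independent set has at most \<open>m\<close> vertices and, with its
  neighbourhoods, covers \<open>A\<close>. A neighbourhood contains no clique with one vertex fewer,
  since its centre would extend it, so induction on \<open>k\<close> bounds its size.\<close>

lemma card_less_of_clique_free:
  assumes "finite A" and "\<And>u v. R u v \<Longrightarrow> R v u"
    and indep: "\<And>I. I \<subseteq> A \<Longrightarrow> (\<forall>u\<in>I. \<forall>v\<in>I. u \<noteq> v \<longrightarrow> \<not> R u v) \<Longrightarrow> card I \<le> m"
    and "\<not> (\<exists>K\<subseteq>A. card K = k \<and> (\<forall>u\<in>K. \<forall>v\<in>K. u \<noteq> v \<longrightarrow> R u v))"
  shows "card A < (m + 1) ^ k"
  using assms(1,3,4)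
proof (induction k arbitrary: A)
  case 0
  \<comment> \<open>The empty set is a clique on 0 vertices, so the hypothesis is
    contradictory.\<close>
  then show ?case by (metis card.empty empty_iff empty_subsetI)
next
  case (Suc k)
  define N where "N v = {u \<in> A. u \<noteq> v \<and> R v u}" for v
  define indeps where "indeps = {I. I \<subseteq> A \<and> (\<forall>u\<in>I. \<forall>v\<in>I. u \<noteq> v \<longrightarrow> \<not> R u v)}"
  have "finite indeps"
    using Suc.prems(1) by (auto simp: indeps_def)
  moreover have "{} \<in> indeps"
    by (simp add: indeps_def)
  ultimately obtain I where I: "I \<in> indeps" and max: "\<And>J. J \<in> indeps \<Longrightarrow> I \<subseteq> J \<Longrightarrow> I = J"
    using finite_has_maximal2[of indeps "{}"] by metis
  have "finite I"
    using I Suc.prems(1) by (auto simp: indeps_def intro: finite_subset)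
  have card_N: "card (N v) < (m + 1) ^ k" if "v \<in> A" for v
  proof (rule Suc.IH)
    show "finite (N v)"
      using Suc.prems(1) by (simp add: N_def)
    show "card J \<le> m" if "J \<subseteq> N v" "\<forall>u\<in>J. \<forall>v\<in>J. u \<noteq> v \<longrightarrow> \<not> R u v" for J
      using that by (intro Suc.prems(2)) (auto simp: N_def)
    show "\<not> (\<exists>K\<subseteq>N v. card K = k \<and> (\<forall>u\<in>K. \<forall>v\<in>K. u \<noteq> v \<longrightarrow> R u v))"
    proof
      assume "\<exists>K\<subseteq>N v. card K = k \<and> (\<forall>u\<in>K. \<forall>v\<in>K. u \<noteq> v \<longrightarrow> R u v)"
      then obtain K where K: "K \<subseteq> N v" "card K = k" "\<forall>u\<in>K. \<forall>v\<in>K. u \<noteq> v \<longrightarrow> R u v"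
        by blast
      have "finite K"
        using K(1) \<open>finite (N v)\<close> by (rule finite_subset)
      then have "card (insert v K) = Suc k"
        using K(1,2) by (subst card_insert_disjoint) (auto simp: N_def)
      moreover have "insert v K \<subseteq> A"
        using K(1) \<open>v \<in> A\<close> by (auto simp: N_def)
      moreover have "\<forall>u\<in>insert v K. \<forall>w\<in>insert v K. u \<noteq> w \<longrightarrow> R u w"
        using K(1,3) assms(2) by (auto simp: N_def)
      ultimately show False
        using Suc.prems(3) by blast
    qed
  qed
  have "A \<subseteq> (\<Union>v\<in>I. insert v (N v))"
  proof
    fix a assume "a \<in> A"
    show "a \<in> (\<Union>v\<in>I. insert v (N v))"
    proof (rule ccontr)
      assume a: "a \<notin> (\<Union>v\<in>I. insert v (N v))"
      \<comment> \<open>A vertex outside \<open>I\<close> with no neighbour in \<open>I\<close>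
        could be added to it, against maximality.\<close>
      then have "insert a I \<in> indeps"
        using I \<open>a \<in> A\<close> assms(2) by (auto simp: indeps_def N_def)
      then show False
        using max[of "insert a I"] a by auto
    qed
  qed
  moreover have "finite (N v)" for v
    using Suc.prems(1) by (simp add: N_def)
  ultimately have "card A \<le> card (\<Union>v\<in>I. insert v (N v))"
    using \<open>finite I\<close> by (intro card_mono) auto
  also have "\<dots> \<le> (\<Sum>v\<in>I. card (insert v (N v)))"
    using \<open>finite I\<close> by (rule card_UN_le)
  also have "\<dots> \<le> (\<Sum>v\<in>I. (m + 1) ^ k)"
  proof (rule sum_mono)
    fix v assume "v \<in> I"
    \<comment> \<open>The strict bound leaves room for the vertex \<open>v\<close> itself.\<close>
    then have "card (N v) < (m + 1) ^ k"
      using I by (intro card_N) (auto simp: indeps_def)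
    then show "card (insert v (N v)) \<le> (m + 1) ^ k"
      using card_insert_le_m1[of "(m + 1) ^ k" "N v" v] by simp
  qed
  also have "\<dots> \<le> m * (m + 1) ^ k"
    using I Suc.prems(2) by (simp add: indeps_def)
  also have "\<dots> < (m + 1) ^ Suc k"
    by simp
  finally show ?case .
qed

section \<open>Polarization and the final bound\<close>

text \<open>Polarization: for a = u - v and b = v - w one has a + b = u - w, hence 2<a,b> = Q(a+b) -
  Q(a) - Q(b), and 2 can be cancelled.\<close>

lemma orthogonal_of_isotropic_differences:
  fixes u v w :: "'a::field vec"
  assumes "(2 :: 'a) \<noteq> 0"
    and "u \<in> carrier_vec n" "v \<in> carrier_vec n" "w \<in> carrier_vec n"
    and "(u - v) \<bullet> (u - v) = 0" "(v - w) \<bullet> (v - w) = 0" "(u - w) \<bullet> (u - w) = 0"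
  shows "(u - v) \<bullet> (v - w) = 0"
proof -
  have "2 * ((u - v) \<bullet> (v - w))
      = (u - w) \<bullet> (u - w) - (u - v) \<bullet> (u - v) - (v - w) \<bullet> (v - w)"
    using assms(2-4) comm_scalar_prod[of u n v] comm_scalar_prod[of v n w] comm_scalar_prod[of u n w]
    by (simp add: minus_scalar_prod_distrib[of _ n] scalar_prod_minus_distrib[of _ n] algebra_simps)
  then show ?thesis
    using assms by simp
qed

theorem mainTheorem7:
  fixes k p l q :: nat
  assumes "k \<ge> 1"
    and "prime p" and "l \<ge> 1" and "q = p ^ l" and "odd q" and "p \<ge> k"
    and "CARD('a :: {field, finite}) = q"
  shows "\<exists>C :: real. \<forall>n \<ge> 1. \<forall>A \<subseteq> (carrier_vec n :: 'a vec set).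
    \<not> (\<exists>x :: nat \<Rightarrow> 'a vec. inj_on x {1..k} \<and> x ` {1..k} \<subseteq> A \<and>
        (\<forall>i \<in> {1..k}. \<forall>j \<in> {1..k}. \<forall>m \<in> {1..k}. i \<noteq> j \<and> j \<noteq> m \<and> i \<noteq> m \<longrightarrow>
          (x i - x j) \<bullet> (x j - x m) = 0))
    \<longrightarrow> real (card A) \<le> C * real n ^ ((k + 1) * (q - 1))"
\<comment> \<open>The constant is the factor free of \<open>n\<close> in the \<open>k\<close>-th
  power of 3 (3n)^(q-1), which bounds the base of the Ramsey estimate.\<close>
proof (rule exI[of _ "(3 * 3 ^ (q - 1)) ^ k"], intro allI impI)
  fix n :: nat and A :: "'a vec set"
  assume n: "n \<ge> 1" and A: "A \<subseteq> carrier_vec n"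
    and free: "\<not> (\<exists>x :: nat \<Rightarrow> 'a vec. inj_on x {1..k} \<and> x ` {1..k} \<subseteq> A \<and>
        (\<forall>i \<in> {1..k}. \<forall>j \<in> {1..k}. \<forall>m \<in> {1..k}. i \<noteq> j \<and> j \<noteq> m \<and> i \<noteq> m \<longrightarrow>
          (x i - x j) \<bullet> (x j - x m) = 0))"
  \<comment> \<open>Membership in \<open>A\<close> is part of \<open>R\<close> so that symmetry
    holds for all \<open>u\<close> and \<open>v\<close>: it supplies the dimensions that the scalar
    product laws require.\<close>
  define R where "R u v \<longleftrightarrow> u \<in> A \<and> v \<in> A \<and> (u - v) \<bullet> (u - v) = 0" for u v
  let ?m = "(n + 2) ^ (q - 1) + 1"
  have "finite A"
    using A finite_carrier_vec by (rule finite_subset)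
  have "card A < (?m + 1) ^ k"
  proof (rule card_less_of_clique_free)
    show "finite A" by fact
    show "R v u" if "R u v" for u v
      using that A comm_scalar_prod[of u n v]
      by (auto simp: R_def scalar_prod_minus_minus[of _ n] subset_iff add.commute)
    show "card I \<le> ?m" if "I \<subseteq> A" "\<forall>u\<in>I. \<forall>v\<in>I. u \<noteq> v \<longrightarrow> \<not> R u v" for I
      unfolding assms(7)[symmetric]
      by (rule card_anisotropic_differences_le) (use that A in \<open>auto simp: R_def subset_iff\<close>)
    show "\<not> (\<exists>K\<subseteq>A. card K = k \<and> (\<forall>u\<in>K. \<forall>v\<in>K. u \<noteq> v \<longrightarrow> R u v))"
    proof
      assume "\<exists>K\<subseteq>A. card K = k \<and> (\<forall>u\<in>K. \<forall>v\<in>K. u \<noteq> v \<longrightarrow> R u v)"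
      then obtain K where K: "K \<subseteq> A" "card K = k" "\<forall>u\<in>K. \<forall>v\<in>K. u \<noteq> v \<longrightarrow> R u v"
        by blast
      \<comment> \<open>Enumerating the clique turns it into a forbidden configuration.\<close>
      obtain x where x: "bij_betw x {1..k} K"
        using ex_bij_betw_nat_finite_1[of K] K(1,2) \<open>finite A\<close> finite_subset by metis
      have mem: "x i \<in> carrier_vec n" if "i \<in> {1..k}" for i
        using that bij_betw_apply[OF x] K(1) A by blast
      have R: "R (x i) (x j)" if "i \<in> {1..k}" "j \<in> {1..k}" "i \<noteq> j" for i j
        using that K(3) bij_betw_apply[OF x] bij_betw_imp_inj_on[OF x] by (auto simp: inj_on_eq_iff)
      have orth: "(x i - x j) \<bullet> (x j - x l) = 0"
        if "i \<in> {1..k}" "j \<in> {1..k}" "l \<in> {1..k}" "i \<noteq> j" "j \<noteq> l" "i \<noteq> l" for i j l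
      proof (rule orthogonal_of_isotropic_differences)
        show "(2 :: 'a) \<noteq> 0"
          using assms(5,7) by (intro two_neq_zero_of_odd_card) simp
      qed (use that R mem in \<open>simp_all add: R_def\<close>)
      show False
      proof (rule notE[OF free], intro exI[of _ x] conjI ballI impI)
        show "inj_on x {1..k}" "x ` {1..k} \<subseteq> A"
          using K(1) bij_betw_imp_inj_on[OF x] bij_betw_imp_surj_on[OF x] by simp_all
      qed (use orth in blast)
    qed
  qed
  also have "(?m + 1) ^ k \<le> (3 * (3 * n) ^ (q - 1)) ^ k"
  proof (rule power_mono)
    \<comment> \<open>For n \<ge> 1, n + 2 is at most 3n, and each of the two extra units is at most
      (3n)^(q-1).\<close>
    have "(n + 2) ^ (q - 1) \<le> (3 * n) ^ (q - 1)"
      using n by (intro power_mono) auto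
    moreover have "1 \<le> (3 * n) ^ (q - 1)"
      using n by (intro one_le_power) auto
    ultimately show "?m + 1 \<le> 3 * (3 * n) ^ (q - 1)"
      by linarith
  qed simp
  also have "\<dots> = (3 * 3 ^ (q - 1)) ^ k * n ^ (k * (q - 1))"
    by (simp only: power_mult_distrib mult.assoc power_mult[symmetric] mult.commute[of k])
  \<comment> \<open>The argument yields the exponent k(q-1); since n \<ge> 1, it may be raised to
    the one claimed.\<close>
  also have "\<dots> \<le> (3 * 3 ^ (q - 1)) ^ k * n ^ ((k + 1) * (q - 1))"
    using n by (intro mult_left_mono power_increasing) auto
  finally have "card A \<le> (3 * 3 ^ (q - 1)) ^ k * n ^ ((k + 1) * (q - 1))"
    by (rule less_imp_le)
  then have "real (card A) \<le> real ((3 * 3 ^ (q - 1)) ^ k * n ^ ((k + 1) * (q - 1)))"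
    by (simp only: of_nat_le_iff)
  then show "real (card A) \<le> (3 * 3 ^ (q - 1)) ^ k * real n ^ ((k + 1) * (q - 1))"
    by (simp only: of_nat_mult of_nat_power of_nat_numeral)
qed

end
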